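(* There is an algorithm that, given a binary word $x$, computes the number $b = \nu x$ of ones in the binary representation of $x$ in $O(\log\log b)$ steps, under the unit cost measure for logical and arithmetical operations including multiplication.
   Context: For a nonnegative integer $x$ written as a binary word, $\nu x$ denotes the number of ones in its binary representation (the "population count" or "sideways addition" of $x$). The model of computation is a machine operating on binary words (integers) in which each of the following operations counts as one step (unit cost measure): bit-wise logical operations (such as bit-wise and), and arithmetical operations including addition, subtraction, multiplication and (integer) division; constant masks and table look-ups of constants are available. *)

theory Defs
  imports Complex_Main "HOL-Library.Landau_Symbols"
begin

unbundle bit_operations_syntax

definition ones :: "nat \<Rightarrow> nat" where
  "ones x = card {i. bit x i}"

text \<open>
  A register machine on natural numbers of unbounded size. There is no variable shift and no
  exponentiation: they would be far stronger than the listed operations.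
\<close>

datatype binop = And | Or | Xor | Add | Sub | Mult | Div

text \<open>Subtraction is truncated at zero, and division by zero yields zero.\<close>

fun eval_op :: "binop \<Rightarrow> nat \<Rightarrow> nat \<Rightarrow> nat" where
  "eval_op And a b = a AND b"
| "eval_op Or a b = a OR b"
| "eval_op Xor a b = a XOR b"
| "eval_op Add a b = a + b"
| "eval_op Sub a b = a - b"
| "eval_op Mult a b = a * b"
| "eval_op Div a b = a div b"

datatype instr =
    Const nat nat            \<comment> \<open>\<open>r\<^sub>i := c\<close>\<close>
  | Op binop nat nat nat     \<comment> \<open>\<open>r\<^sub>i := r\<^sub>j \<circ> r\<^sub>k\<close>\<close>
  | Lookup nat nat           \<comment> \<open>\<open>r\<^sub>i := table[r\<^sub>j]\<close>, or \<open>0\<close> if the index is out of range\<close>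
  | Goto nat
  | If_Zero nat nat          \<comment> \<open>if \<open>r\<^sub>i = 0\<close> then go to the given line\<close>

type_synonym config = "nat \<times> (nat \<Rightarrow> nat)"

fun exec :: "nat list \<Rightarrow> instr \<Rightarrow> config \<Rightarrow> config" where
  "exec tab (Const i c) (pc, r) = (Suc pc, r(i := c))"
| "exec tab (Op f i j k) (pc, r) = (Suc pc, r(i := eval_op f (r j) (r k)))"
| "exec tab (Lookup i j) (pc, r) = (Suc pc, r(i := if r j < length tab then tab ! r j else 0))"
| "exec tab (Goto l) (pc, r) = (l, r)"
| "exec tab (If_Zero i l) (pc, r) = (if r i = 0 then l else Suc pc, r)"

definition halted :: "instr list \<Rightarrow> config \<Rightarrow> bool" where
  "halted P c \<longleftrightarrow> fst c \<ge> length P"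

definition step :: "nat list \<Rightarrow> instr list \<Rightarrow> config \<Rightarrow> config" where
  "step tab P c = (if halted P c then c else exec tab (P ! fst c) c)"

text \<open>
  Input and output are in register 0, all other registers initially hold 0. Every executed
  instruction, including jumps and loading of constants, costs one step. A halted configuration
  is a fixed point of \<^const>\<open>step\<close>, so \<open>t\<close> is an upper bound on the running time.
\<close>

definition computes_within :: "nat list \<Rightarrow> instr list \<Rightarrow> nat \<Rightarrow> nat \<Rightarrow> nat \<Rightarrow> bool" where
  "computes_within tab P x y t \<longleftrightarrow>
     (let c = (step tab P ^^ t) (0, (\<lambda>_. 0)(0 := x)) in halted P c \<and> snd c 0 = y)"

text \<open>
  Algorithms for words of arbitrary length: one program \<open>P\<close> serves all word lengths \<open>n\<close>, only
  the constants in the table (such as masks) may depend on \<open>n\<close>. They are \<open>n\<close>-bit words, and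
  there are \<open>O(log n)\<close> of them. Without such limits the notion would be vacuous: the table could
  list all results, or a single huge constant could encode them.
\<close>

definition admissible_tables :: "(nat \<Rightarrow> nat list) \<Rightarrow> bool" where
  "admissible_tables T \<longleftrightarrow>
     (\<forall>n. set (T n) \<subseteq> {..<2 ^ n}) \<and>
     (\<lambda>n. real (length (T n))) \<in> O(\<lambda>n. log 2 (real n))"

end

theory Submission
  imports Defs "HOL-Library.Discrete_Functions" "HOL-Real_Asymp.Real_Asymp"
begin

text \<open>
  After \<open>k\<close> rounds of the classical sideways addition, the word \<open>y\<close> consists of digits \<open>c\<^sub>i \<le> 2^k\<close>
  in base \<open>B = 2^(2^k)\<close> whose sum is \<open>b\<close>. If \<open>b < B div 2\<close>, casting out \<open>B - 1\<close> gives \<open>b\<close>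
  at once, and \<open>k\<close> of order \<open>log log b\<close> suffices for this. Since \<open>b\<close> is not known, the
  condition has to be tested in constant time. Multiplying \<open>y\<close> by \<open>1 + B + B\<^sup>2 + \<dots>\<close> yields the
  prefix sums of the digits, up to carries. A digit is at most \<open>B div 2\<close>, so the prefix sums
  cannot jump over the interval from \<open>B div 2\<close> to \<open>B - 1\<close>; the first one that reaches \<open>B div 2\<close>
  is not yet disturbed by carries and has its top bit set. Hence \<open>b < B div 2\<close> iff no digit of
  the product has its top bit set. All masks are obtained by division from \<open>2^(2^K) - 1\<close> where
  \<open>2^K\<close> exceeds the word length.
\<close>

section \<open>Words as digit sequences\<close>

lemma and_add_mult_power2:
  fixes p q u v :: nat
  assumes "p < 2 ^ r" "q < 2 ^ r"
  shows "(p + 2 ^ r * u) AND (q + 2 ^ r * v) = (p AND q) + 2 ^ r * (u AND v)"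
proof -
  let ?a = "p + 2 ^ r * u" and ?b = "q + 2 ^ r * v"
  have t: "take_bit r ?a = p" "take_bit r ?b = q"
    using assms by (simp_all add: take_bit_eq_mod)
  have d: "drop_bit r ?a = u" "drop_bit r ?b = v"
    using assms by (simp_all add: drop_bit_eq_div)
  have "?a AND ?b = take_bit r (?a AND ?b) + 2 ^ r * drop_bit r (?a AND ?b)"
    by (simp add: take_bit_eq_mod drop_bit_eq_div)
  then show ?thesis
    by (simp add: t d)
qed

abbreviation digits_value :: "nat \<Rightarrow> nat list \<Rightarrow> nat" where
  "digits_value B cs \<equiv> horner_sum (\<lambda>c. c) B cs"

fun adjacent_sums :: "nat list \<Rightarrow> nat list" where
  "adjacent_sums (a # b # cs) = (a + b) # adjacent_sums cs"
| "adjacent_sums cs = cs"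

lemma sum_list_adjacent_sums: "sum_list (adjacent_sums cs) = sum_list cs"
  by (induction cs rule: adjacent_sums.induct) simp_all

lemma length_adjacent_sums: "even (length cs) \<Longrightarrow> 2 * length (adjacent_sums cs) = length cs"
  by (induction cs rule: adjacent_sums.induct) simp_all

lemma adjacent_sums_le:
  "\<forall>c\<in>set cs. c \<le> w \<Longrightarrow> c \<in> set (adjacent_sums cs) \<Longrightarrow> c \<le> 2 * w"
  by (induction cs rule: adjacent_sums.induct) auto

primrec repunit :: "nat \<Rightarrow> nat \<Rightarrow> nat" where
  "repunit B 0 = 0"
| "repunit B (Suc m) = 1 + B * repunit B m"

lemma repunit_mult: "(B - 1) * repunit B m = B ^ m - 1" if B: "B > 0"
proof -
  obtain A where A: "B = Suc A"
    using B gr0_implies_Suc by blast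
  have "A * repunit B m + 1 = B ^ m"
  proof (induction m)
    case (Suc m)
    have "A * repunit B (Suc m) + 1 = B * (A * repunit B m + 1)"
      by (simp add: algebra_simps) (simp add: A)
    with Suc show ?case
      by simp
  qed simp
  then show ?thesis
    by (simp add: A)
qed

lemma repunit_Suc': "repunit B (Suc m) = repunit B m + B ^ m"
  by (induction m) (auto simp: algebra_simps)

lemma repunit_eq_div: "(B ^ m - 1) div (B - 1) = repunit B m" if "B \<ge> 2"
  using that repunit_mult[of B m, symmetric] by simp

lemma half_mask_eq_div:
  assumes "B \<ge> 2"
  shows "(B ^ (2 * m) - 1) div (B + 1) = (B - 1) * repunit (B\<^sup>2) m"
proof -
  have "(B + 1) * ((B - 1) * repunit (B\<^sup>2) m) = (B\<^sup>2 - 1) * repunit (B\<^sup>2) m"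
    by (simp add: power2_eq_square algebra_simps)
  also have "\<dots> = B ^ (2 * m) - 1"
    using assms by (subst repunit_mult) (auto simp: power_mult)
  finally show ?thesis
    by (metis nonzero_mult_div_cancel_left add_is_0 one_neq_zero)
qed

lemma digits_value_mod:
  "digits_value B cs mod (B - 1) = sum_list cs mod (B - 1)" if B: "B \<ge> 2"
proof (induction cs)
  case (Cons c cs)
  obtain A where A: "B = Suc A"
    using B by (cases B) auto
  have "digits_value B (c # cs) = (c + digits_value B cs) + (B - 1) * digits_value B cs"
    by (simp add: A)
  then have "digits_value B (c # cs) mod (B - 1) = (c + digits_value B cs) mod (B - 1)"
    by (simp only: mod_mult_self2)
  also have "\<dots> = (c + sum_list cs) mod (B - 1)"
    by (rule mod_add_cong[OF refl Cons])
  finally show ?case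
    by simp
qed simp

section \<open>A round of sideways addition\<close>

lemma and_half_mask:
  fixes a u :: nat
  assumes "a < 2 ^ w"
  shows "(a + 2 ^ w * u) AND ((2 ^ w - 1) * repunit ((2 ^ w)\<^sup>2) (Suc m)) =
    a + (2 ^ w)\<^sup>2 * ((u div 2 ^ w) AND ((2 ^ w - 1) * repunit ((2 ^ w)\<^sup>2) m))"
proof -
  let ?B = "2 ^ w :: nat" and ?M = "(2 ^ w - 1) * repunit ((2 ^ w)\<^sup>2) m"
  have sq: "?B\<^sup>2 = 2 ^ (2 * w)"
    by (simp add: power_mult mult.commute)
  have "a + ?B * u = (a + ?B * (u mod ?B)) + ?B\<^sup>2 * (u div ?B)"
    by (simp add: power2_eq_square algebra_simps flip: distrib_left)
  moreover have "(?B - 1) * repunit (?B\<^sup>2) (Suc m) = (?B - 1) + ?B\<^sup>2 * ?M"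
    by (simp add: algebra_simps)
  moreover have "a + ?B * (u mod ?B) < 2 ^ (2 * w)"
  proof -
    have "a + ?B * (u mod ?B) < ?B * (u mod ?B + 1)"
      using assms by simp
    also have "\<dots> \<le> ?B * ?B"
      by (intro mult_left_mono) (simp_all add: Suc_le_eq)
    finally show ?thesis
      by (simp add: sq flip: power2_eq_square)
  qed
  moreover have "?B - 1 < 2 ^ (2 * w)"
    by (rule less_le_trans[of _ ?B]) simp_all
  moreover have "(a + ?B * (u mod ?B)) AND (?B - 1) = a"
  proof -
    have "(a + ?B * (u mod ?B)) AND (?B - 1) = take_bit w (a + ?B * (u mod ?B))"
      by (simp only: take_bit_eq_mask mask_eq_exp_minus_1)
    then show ?thesis
      using assms by (simp add: take_bit_eq_mod)
  qed
  ultimately show ?thesis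
    using and_add_mult_power2[of _ "2 * w"] unfolding sq by metis
qed

lemma sideways_addition_round:
  assumes "even (length cs)" "\<forall>c\<in>set cs. c < B" "B = 2 ^ w"
    and mask: "\<mu> = (B - 1) * repunit (B\<^sup>2) (length cs div 2)"
  shows "(digits_value B cs AND \<mu>) + ((digits_value B cs div B) AND \<mu>) =
    digits_value (B\<^sup>2) (adjacent_sums cs)"
  using assms(1,2) unfolding mask
proof (induction cs rule: adjacent_sums.induct)
  case (1 a b cs)
  let ?M = "(B - 1) * repunit (B\<^sup>2) (length cs div 2)"
  let ?M' = "(B - 1) * repunit (B\<^sup>2) (Suc (length cs div 2))"
  let ?v = "digits_value B cs"
  have ab: "a < B" "b < B"
    using 1 by auto
  have "digits_value B (a # b # cs) AND ?M' = a + B\<^sup>2 * (?v AND ?M)"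
    using and_half_mask[of a w "b + B * ?v"] ab assms(3) by simp
  moreover have "(digits_value B (a # b # cs) div B) AND ?M' = b + B\<^sup>2 * ((?v div B) AND ?M)"
    using and_half_mask[of b w ?v] ab assms(3) by simp
  ultimately have "(digits_value B (a # b # cs) AND ?M') + ((digits_value B (a # b # cs) div B) AND ?M')
     = a + b + B\<^sup>2 * ((?v AND ?M) + ((?v div B) AND ?M))"
    by (simp only: distrib_left)
  also have "\<dots> = digits_value (B\<^sup>2) (adjacent_sums (a # b # cs))"
    using 1 by simp
  finally show ?case
    by simp
qed simp_all

section \<open>The overflow test\<close>

primrec prefix_sums_value :: "nat \<Rightarrow> nat \<Rightarrow> nat list \<Rightarrow> nat" where
  "prefix_sums_value B s [] = 0"
| "prefix_sums_value B s (c # cs) = (s + c) + B * prefix_sums_value B (s + c) cs"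

lemma prefix_sums_value_shift:
  "prefix_sums_value B s cs = s * repunit B (length cs) + prefix_sums_value B 0 cs"
proof (induction cs arbitrary: s)
  case (Cons c cs)
  show ?case
    unfolding prefix_sums_value.simps Cons[of "s + c"] Cons[of "0 + c"]
    by (simp add: algebra_simps)
qed simp

lemma digits_value_mult_repunit:
  "\<exists>R. digits_value B cs * repunit B (length cs) = prefix_sums_value B 0 cs + B ^ length cs * R"
proof (induction cs)
  case (Cons c cs)
  let ?m = "length cs" and ?v = "digits_value B cs"
  from Cons obtain R where R: "?v * repunit B ?m = prefix_sums_value B 0 cs + B ^ ?m * R"
    by blast
  have "digits_value B (c # cs) * repunit B (length (c # cs)) =
      c * repunit B (Suc ?m) + B * (?v * repunit B ?m) + B ^ Suc ?m * ?v"
    by (simp only: horner_sum_simps length_Cons repunit_Suc') (simp add: algebra_simps)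
  also have "\<dots> = prefix_sums_value B 0 (c # cs) + B ^ length (c # cs) * (R + ?v)"
    unfolding R prefix_sums_value.simps prefix_sums_value_shift[of B "0 + c"]
    by (simp add: algebra_simps)
  finally show ?case
    by blast
qed simp

lemma prefix_sums_value_and_eq_0_iff:
  fixes h :: nat
  assumes "\<forall>c\<in>set cs. c \<le> 2 ^ h" "s < 2 ^ h"
  shows "prefix_sums_value (2 ^ Suc h) s cs AND (2 ^ h * repunit (2 ^ Suc h) (length cs)) = 0
    \<longleftrightarrow> s + sum_list cs < 2 ^ h"
  using assms
proof (induction cs arbitrary: s)
  case (Cons c cs)
  let ?Z = "prefix_sums_value (2 ^ Suc h) (s + c) cs"
  let ?M = "2 ^ h * repunit (2 ^ Suc h) (length cs)"
  have lt: "s + c < 2 ^ Suc h" "(2::nat) ^ h < 2 ^ Suc h"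
    using Cons.prems by auto
  have "prefix_sums_value (2 ^ Suc h) s (c # cs) AND (2 ^ h * repunit (2 ^ Suc h) (length (c # cs))) =
      ((s + c) + 2 ^ Suc h * ?Z) AND (2 ^ h + 2 ^ Suc h * ?M)"
    by (simp add: algebra_simps)
  also have "\<dots> = ((s + c) AND 2 ^ h) + 2 ^ Suc h * (?Z AND ?M)"
    using lt by (rule and_add_mult_power2)
  finally have eq: "prefix_sums_value (2 ^ Suc h) s (c # cs) AND
      (2 ^ h * repunit (2 ^ Suc h) (length (c # cs))) = 0 \<longleftrightarrow> (s + c) AND 2 ^ h = 0 \<and> ?Z AND ?M = 0"
    by simp
  show ?case
  proof (cases "s + c < 2 ^ h")
    case True
    then have "(s + c) AND 2 ^ h = 0"
      by (simp add: and_exp_eq_0_iff_not_bit bit_iff_odd)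
    moreover have "?Z AND ?M = 0 \<longleftrightarrow> s + c + sum_list cs < 2 ^ h"
      using Cons.IH[of "s + c"] Cons.prems True by simp
    ultimately show ?thesis
      unfolding eq by (simp add: add.assoc)
  next
    case False
    then have "(s + c) div 2 ^ h = 1"
      using lt by (intro div_nat_eqI) auto
    then have "(s + c) AND 2 ^ h \<noteq> 0"
      by (simp add: and_exp_eq_0_iff_not_bit bit_iff_odd)
    then show ?thesis
      unfolding eq using False by simp
  qed
qed simp

lemma overflow_test:
  fixes h :: nat
  assumes "\<forall>c\<in>set cs. c \<le> 2 ^ h" and B: "B = 2 ^ Suc h"
  shows "(digits_value B cs * repunit B (length cs)) AND ((B div 2) * repunit B (length cs)) = 0
    \<longleftrightarrow> sum_list cs < B div 2"
proof -
  let ?m = "length cs" and ?Z = "prefix_sums_value B 0 cs"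
  let ?M = "2 ^ h * repunit B ?m"
  have E: "B ^ ?m = 2 ^ (Suc h * ?m)"
    by (simp only: B power_mult)
  have half: "B div 2 = 2 ^ h"
    by (simp add: B)
  obtain R where R: "digits_value B cs * repunit B ?m = ?Z + B ^ ?m * R"
    using digits_value_mult_repunit by blast
  have "?M \<le> (B - 1) * repunit B ?m"
    by (intro mult_right_mono) (simp_all add: B)
  also have "\<dots> = B ^ ?m - 1"
    by (intro repunit_mult) (simp add: B)
  also have "\<dots> < B ^ ?m"
    by (simp add: B)
  finally have M: "?M < 2 ^ (Suc h * ?m)"
    by (simp only: E)
  have tM: "take_bit (Suc h * ?m) ?M = ?M"
    using M by (rule take_bit_nat_eq_self)
  have and_M: "z AND ?M = take_bit (Suc h * ?m) z AND ?M" for z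
  proof -
    have "z AND take_bit (Suc h * ?m) ?M = take_bit (Suc h * ?m) z AND take_bit (Suc h * ?m) ?M"
      by (rule bit_eqI) (auto simp: bit_simps)
    then show ?thesis
      by (simp only: tM)
  qed
  have "take_bit (Suc h * ?m) (?Z + B ^ ?m * R) = take_bit (Suc h * ?m) ?Z"
    unfolding E by (simp only: take_bit_eq_mod mod_mult_self2)
  then have "(?Z + B ^ ?m * R) AND ?M = ?Z AND ?M"
    by (metis and_M)
  moreover have "?Z AND ?M = 0 \<longleftrightarrow> sum_list cs < 2 ^ h"
    using prefix_sums_value_and_eq_0_iff[OF assms(1), of 0] by (simp add: B)
  ultimately show ?thesis
    by (simp only: half R)
qed

section \<open>The program\<close>

text \<open>
  Register 0 holds \<open>y\<close>, register 1 the number \<open>2^(2^K) - 1\<close>, register 3 the base \<open>B\<close>;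
  registers 2 and 4 hold the constants 1 and 2. The loop starts at line 7.
\<close>

definition popcount_program :: "instr list" where
  "popcount_program =
    [Lookup 1 1, Const 2 1, Op Add 1 1 2, Op Mult 1 1 1, Op Sub 1 1 2, Const 3 2, Const 4 2,
     Op Sub 5 3 2, Op Div 6 1 5, Op Mult 7 0 6, Op Div 8 3 4, Op Mult 8 8 6, Op And 7 7 8,
     If_Zero 7 22,
     Op Add 5 3 2, Op Div 5 1 5, Op And 6 0 5, Op Div 7 0 3, Op And 7 7 5, Op Add 0 6 7,
     Op Mult 3 3 3, Goto 7,
     Op Div 6 0 5, Op Mult 6 6 5, Op Sub 0 0 6]"

lemma length_popcount_program: "length popcount_program = 25"
  by (simp add: popcount_program_def)

lemmas popcount_program_nth = arg_cong[OF popcount_program_def, of "\<lambda>P. P ! pc" for pc]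

lemma step_popcount_program:
  "pc < 25 \<Longrightarrow> step tab popcount_program (pc, r) = exec tab (popcount_program ! pc) (pc, r)"
  by (simp add: step_def halted_def length_popcount_program)

lemma funpow_numeral: "(f ^^ numeral m) x = (f ^^ pred_numeral m) (f x)"
  by (simp add: numeral_eq_Suc funpow_swap1)

definition loop_registers :: "(nat \<Rightarrow> nat) \<Rightarrow> nat \<Rightarrow> nat \<Rightarrow> nat \<Rightarrow> bool" where
  "loop_registers r E y B \<longleftrightarrow> r 0 = y \<and> r 1 = E - 1 \<and> r 2 = 1 \<and> r 3 = B \<and> r 4 = 2"

lemma run_init:
  "\<exists>r. (step [c] popcount_program ^^ 7) (0, (\<lambda>_. 0)(0 := x)) = (7, r) \<and>
    loop_registers r ((c + 1)\<^sup>2) x 2"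
  by (simp add: funpow_numeral step_popcount_program popcount_program_nth loop_registers_def power2_eq_square)

lemma run_exit:
  assumes "loop_registers r E y B"
    and "(y * ((E - 1) div (B - 1))) AND ((B div 2) * ((E - 1) div (B - 1))) = 0"
  shows "\<exists>r'. (step tab popcount_program ^^ 10) (7, r) = (25, r') \<and> r' 0 = y mod (B - 1)"
  using assms
  by (simp add: funpow_numeral step_popcount_program popcount_program_nth loop_registers_def
      minus_div_mult_eq_mod)

lemma run_round:
  assumes "loop_registers r E y B"
    and "(y * ((E - 1) div (B - 1))) AND ((B div 2) * ((E - 1) div (B - 1))) \<noteq> 0"
    and "\<mu> = (E - 1) div (B + 1)"
  shows "\<exists>r'. (step tab popcount_program ^^ 15) (7, r) = (7, r') \<and>
    loop_registers r' E ((y AND \<mu>) + ((y div B) AND \<mu>)) (B\<^sup>2)"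
  using assms
  by (simp add: funpow_numeral step_popcount_program popcount_program_nth loop_registers_def power2_eq_square)

lemma run_halted: "(step tab popcount_program ^^ m) (25, r) = (25, r)"
  by (induction m) (simp_all add: step_def halted_def length_popcount_program)

lemma run_loop:
  fixes cs :: "nat list"
  assumes "loop_registers r E (digits_value B cs) B"
    and "B = 2 ^ 2 ^ k" "E = B ^ length cs" "\<forall>c\<in>set cs. c \<le> 2 ^ k" "sum_list cs = b"
    and "b > 0 \<Longrightarrow> \<exists>K. 2 ^ k * length cs = 2 ^ K \<and> b < 2 ^ K"
    and "b < 2 ^ (2 ^ (k + d) - 1)"
  shows "\<exists>r'. (step tab popcount_program ^^ (15 * d + 10)) (7, r) = (25, r') \<and> r' 0 = b"
  using assms
proof (induction d arbitrary: r B cs k rule: less_induct)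
  case (less d)
  let ?m = "length cs" and ?y = "digits_value B cs" and ?h = "2 ^ k - 1 :: nat"
  note regs = less.prems(1) and B = less.prems(2) and E = less.prems(3) and digits = less.prems(4)
    and sum = less.prems(5) and K = less.prems(6)
    and bound = less.prems(7)
  have B': "B = 2 ^ Suc ?h"
    unfolding B by (rule arg_cong[of _ _ "power 2"]) simp
  have half: "B div 2 = 2 ^ ?h"
    by (simp only: B' power_Suc)
  have B2: "B \<ge> 2"
    using self_le_power[of "2::nat" "2 ^ k"] by (simp add: B)
  have k_le: "k \<le> ?h"
    using less_exp[of k] by linarith
  then have pow_k_le: "(2::nat) ^ k \<le> 2 ^ ?h"
    by (intro power_increasing) simp_all
  have M: "(E - 1) div (B - 1) = repunit B ?m"
    unfolding E using B2 by (rule repunit_eq_div)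
  have test: "(?y * repunit B ?m) AND ((B div 2) * repunit B ?m) = 0 \<longleftrightarrow> b < 2 ^ ?h"
    using overflow_test[of cs ?h B] digits pow_k_le B' sum half by (metis le_trans)
  show ?case
  proof (cases "b < 2 ^ ?h")
    case True
    obtain r' where r': "(step tab popcount_program ^^ 10) (7, r) = (25, r')" "r' 0 = ?y mod (B - 1)"
      using run_exit[OF regs] test True unfolding M by blast
    have "2 ^ ?h \<le> B - 1"
      using half B2 by linarith
    then have "?y mod (B - 1) = b"
      using True digits_value_mod[OF B2, of cs] by (simp only: sum) simp
    then show ?thesis
      using r' by (simp add: funpow_add run_halted)
  next
    case False
    then obtain d' where d: "d = Suc d'"
      using bound by (cases d) auto
    have "b > 0"
      using False by (cases b) auto
    then obtain K where K': "2 ^ k * ?m = 2 ^ K" "b < 2 ^ K"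
      using K by blast
    have "(2::nat) ^ k < 2 ^ K"
      using False pow_k_le K'(2) by linarith
    then have "k < K"
      by simp
    then obtain j where j: "K = Suc (k + j)"
      using less_iff_Suc_add by auto
    then have "?m = 2 * 2 ^ j"
      using K'(1) by (simp add: power_add)
    then have ev: "even ?m" and m2: "2 * (?m div 2) = ?m"
      by simp_all
    have mask: "(E - 1) div (B + 1) = (B - 1) * repunit (B\<^sup>2) (?m div 2)"
      using half_mask_eq_div[OF B2, of "?m div 2"] by (simp only: E m2)
    have lt_B: "\<forall>c\<in>set cs. c < B"
    proof
      fix c assume "c \<in> set cs"
      then have "c \<le> 2 ^ k"
        using digits by blast
      also have "\<dots> < B"
        unfolding B by (intro power_strict_increasing less_exp) simp
      finally show "c < B" .
    qed
    have round: "(?y AND (E - 1) div (B + 1)) + (?y div B AND (E - 1) div (B + 1)) =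
        digits_value (B\<^sup>2) (adjacent_sums cs)"
      by (rule sideways_addition_round[OF ev lt_B B mask])
    obtain r1 where r1: "(step tab popcount_program ^^ 15) (7, r) = (7, r1)"
        "loop_registers r1 E (digits_value (B\<^sup>2) (adjacent_sums cs)) (B\<^sup>2)"
      using run_round[OF regs _ refl, of tab] test False unfolding M round by blast
    have len: "2 * length (adjacent_sums cs) = ?m"
      using ev by (rule length_adjacent_sums)
    have "\<exists>r'. (step tab popcount_program ^^ (15 * d' + 10)) (7, r1) = (25, r') \<and> r' 0 = b"
    proof (rule less.IH[of d' r1 "B\<^sup>2" "adjacent_sums cs" "Suc k"])
      show "B\<^sup>2 = 2 ^ 2 ^ Suc k"
        by (simp add: B mult.commute flip: power_mult)
      show "E = (B\<^sup>2) ^ length (adjacent_sums cs)"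
        by (simp only: E len flip: power_mult)
      show "\<forall>c\<in>set (adjacent_sums cs). c \<le> 2 ^ Suc k"
        using adjacent_sums_le[OF digits] by simp
      have "2 ^ Suc k * length (adjacent_sums cs) = 2 ^ k * (2 * length (adjacent_sums cs))"
        by simp
      then show "\<exists>K. 2 ^ Suc k * length (adjacent_sums cs) = 2 ^ K \<and> b < 2 ^ K"
        using K' unfolding len by metis
    qed (use r1 d sum bound in \<open>simp_all add: sum_list_adjacent_sums\<close>)
    then obtain r' where r': "(step tab popcount_program ^^ (15 * d' + 10)) (7, r1) = (25, r')" "r' 0 = b"
      by blast
    have "(step tab popcount_program ^^ ((15 * d' + 10) + 15)) (7, r) = (25, r')"
      by (subst funpow_add) (simp only: o_apply r1 r')
    with r' show ?thesis
      by (simp add: d add.commute)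
  qed
qed

lemma digits_value_bits: "x < 2 ^ L \<Longrightarrow> digits_value 2 (map (\<lambda>i. of_bool (bit x i)) [0..<L]) = x"
  using horner_sum_bit_eq_take_bit[of x L]
  by (simp add: horner_sum_foldr foldr_map o_def take_bit_nat_eq_self)

lemma bits_subset: "x < 2 ^ L \<Longrightarrow> {i. bit x i} \<subseteq> {0..<L}" for x :: nat
  by (metis (no_types, lifting) atLeastLessThan_iff bit_take_bit_iff le0
      mem_Collect_eq subsetI take_bit_nat_eq_self)

lemma sum_list_bits:
  assumes "x < 2 ^ L"
  shows "sum_list (map (\<lambda>i. of_bool (bit x i)) [0..<L]) = ones x"
proof -
  have "sum_list (map (\<lambda>i. of_bool (bit x i)) [0..<L]) = (\<Sum>i\<in>{0..<L}. of_bool (bit x i) :: nat)"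
    by (simp add: sum_list_distinct_conv_sum_set)
  also have "\<dots> = card ({0..<L} \<inter> {i. bit x i})"
    by simp
  also have "\<dots> = ones x"
    using bits_subset[OF assms] by (simp add: ones_def Int_absorb1)
  finally show ?thesis .
qed

lemma ones_le: "x < 2 ^ n \<Longrightarrow> ones x \<le> n"
  using card_mono[OF finite_atLeastLessThan bits_subset] by (simp add: ones_def)

definition rounds :: "nat \<Rightarrow> nat" where
  "rounds b = Suc (floor_log (floor_log b + 1))"

lemma less_rounds: "b < 2 ^ (2 ^ rounds b - 1)"
proof -
  have "floor_log b + 1 \<le> 2 ^ rounds b - 1"
    using floor_log_exp2_gt[of "floor_log b + 1"] by (simp add: rounds_def)
  then have "(2::nat) ^ (floor_log b + 1) \<le> 2 ^ (2 ^ rounds b - 1)"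
    by (intro power_increasing) simp_all
  then show ?thesis
    using floor_log_exp2_gt[of b] by simp
qed

lemma floor_log_le_log: "b \<ge> 1 \<Longrightarrow> real (floor_log b) \<le> log 2 (real b)"
  by (simp add: floor_log_altdef)

lemma rounds_le: "real (rounds b) \<le> log 2 (log 2 (real b) + 1) + 1" if "b \<ge> 1"
proof -
  have "real (floor_log (floor_log b + 1)) \<le> log 2 (real (floor_log b + 1))"
    by (rule floor_log_le_log) simp
  also have "\<dots> \<le> log 2 (log 2 (real b) + 1)"
    using floor_log_le_log[OF that] by (intro log_mono) simp_all
  finally show ?thesis
    by (simp add: rounds_def)
qed

lemma rounds_bigo: "(\<lambda>b. real (15 * rounds b + 17)) \<in> O(\<lambda>b. log 2 (log 2 (real b)))"
proof -
  have "(\<lambda>b. real (15 * rounds b + 17)) \<in> O(\<lambda>b. 15 * (log 2 (log 2 (real b) + 1) + 1) + 17)"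
    using rounds_le by (intro landau_o.big_mono eventually_mono[OF eventually_ge_at_top[of 1]])
      (fastforce simp: abs_if)
  also have "(\<lambda>b::nat. 15 * (log 2 (log 2 (real b) + 1) + 1) + 17) \<in> O(\<lambda>b. log 2 (log 2 (real b)))"
    by real_asymp
  finally show ?thesis .
qed

text \<open>The entry for \<open>n = 0\<close> is \<open>0\<close>, as it must be less than \<open>2^0\<close>.\<close>

definition popcount_tables :: "nat \<Rightarrow> nat list" where
  "popcount_tables n = [2 ^ (if n = 0 then 0 else 2 ^ floor_log n) - 1]"

lemma admissible_popcount_tables: "admissible_tables popcount_tables"
proof -
  have "(2::nat) ^ (if n = 0 then 0 else 2 ^ floor_log n) - 1 < 2 ^ n" for n
  proof -
    have "(2::nat) ^ (if n = 0 then 0 else 2 ^ floor_log n) \<le> 2 ^ n"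
      using floor_log_exp2_le[of n] by (intro power_increasing) auto
    then show ?thesis
      by (rule order.strict_trans2[rotated]) simp
  qed
  moreover have "(\<lambda>n. 1) \<in> O(\<lambda>n. log 2 (real n))"
    by real_asymp
  ultimately show ?thesis
    by (simp add: admissible_tables_def popcount_tables_def)
qed

lemma popcount_program_correct:
  assumes "x < 2 ^ n"
  shows "computes_within (popcount_tables n) popcount_program x (ones x) (15 * rounds (ones x) + 17)"
proof -
  define L :: nat where "L = (if n = 0 then 0 else 2 ^ Suc (floor_log n))"
  define c :: nat where "c = 2 ^ (if n = 0 then 0 else 2 ^ floor_log n) - 1"
  define cs :: "nat list" where "cs = map (\<lambda>i. of_bool (bit x i)) [0..<L]"
  have "n \<le> L"
    using floor_log_exp2_ge[of n] by (simp add: L_def)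
  then have "(2::nat) ^ n \<le> 2 ^ L"
    by (intro power_increasing) simp_all
  with assms have x: "x < 2 ^ L"
    by linarith
  have c: "(c + 1)\<^sup>2 = 2 ^ L"
    by (simp add: c_def L_def mult.commute flip: power_mult)
  have tab: "popcount_tables n = [c]"
    by (simp add: popcount_tables_def c_def)
  obtain r where r: "(step [c] popcount_program ^^ 7) (0, (\<lambda>_. 0)(0 := x)) = (7, r)"
      "loop_registers r (2 ^ L) x 2"
    using run_init[of c x] unfolding c by blast
  have "\<exists>r'. (step [c] popcount_program ^^ (15 * rounds (ones x) + 10)) (7, r) = (25, r') \<and> r' 0 = ones x"
  proof (rule run_loop[where cs = cs and k = 0 and B = 2 and E = "2 ^ L"])
    show "loop_registers r (2 ^ L) (digits_value 2 cs) 2"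
      using r digits_value_bits[OF x] by (simp add: cs_def)
    show "sum_list cs = ones x"
      using sum_list_bits[OF x] by (simp add: cs_def)
    show "\<exists>K. 2 ^ 0 * length cs = 2 ^ K \<and> ones x < 2 ^ K" if "ones x > 0"
    proof -
      have le: "ones x \<le> n"
        using assms by (rule ones_le)
      then have "length cs = 2 ^ Suc (floor_log n)"
        using that by (simp add: cs_def L_def)
      moreover have "ones x < 2 ^ Suc (floor_log n)"
        using floor_log_exp2_gt[of n] le by simp
      ultimately show ?thesis
        by (metis mult_1 power_0)
    qed
    show "ones x < 2 ^ (2 ^ (0 + rounds (ones x)) - 1)"
      using less_rounds by simp
  qed (auto simp: cs_def)
  then obtain r' where r': "(step [c] popcount_program ^^ (15 * rounds (ones x) + 10)) (7, r) = (25, r')"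
      "r' 0 = ones x"
    by blast
  have "(step [c] popcount_program ^^ ((15 * rounds (ones x) + 10) + 7)) (0, (\<lambda>_. 0)(0 := x)) = (25, r')"
    by (subst funpow_add) (simp only: o_apply r r')
  then show ?thesis
    by (simp add: computes_within_def tab halted_def length_popcount_program r' add.commute)
qed

theorem theorem1:
  "\<exists>(P :: instr list) (T :: nat \<Rightarrow> nat list) (time :: nat \<Rightarrow> nat).
     admissible_tables T \<and>
     (\<lambda>b. real (time b)) \<in> O(\<lambda>b. log 2 (log 2 (real b))) \<and>
     (\<forall>n x. x < 2 ^ n \<longrightarrow> computes_within (T n) P x (ones x) (time (ones x)))"
  by (intro exI[of _ popcount_program] exI[of _ popcount_tables]
      exI[of _ "\<lambda>b. 15 * rounds b + 17"] conjI allI impI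
      admissible_popcount_tables rounds_bigo popcount_program_correct)

end
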